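(* Let $p$ be a prime such that $3\mid(p-1)$ and let $x_1,x_2,x_3\in\mathbb F_p$ be distinct. Let $\Gamma(x_1,x_2,x_3)$ be the projective closure of the affine curve $y^3=(t-x_1)(t-x_2)(t-x_3)$ over $\mathbb F_p$. Then for $j=1,2,3$, $$\int_{\Gamma(x_1,x_2,x_3)}\frac1{t-x_j}=-\,c_j^{p-1}(x_1,x_2,x_3),$$ where $c_j^{p-1}$ are the polynomials defined in the context.
   Context: For a rational function $h$ on $\Gamma=\Gamma(x_1,x_2,x_3)$ with values in $\mathbb F_p$, the integral $\int_{\Gamma}h$ is the sum $\sum h(P)\in\mathbb F_p$ over all $\mathbb F_p$-points $P$ of $\Gamma$ at which $h$ is defined (regular); the points at which $h$ is not defined are omitted. The projective closure is taken in the projective plane; the curve has 3 points at infinity. Consider the expansion in powers of $t$ $$\prod_{s=1}^3(t-z_s)^{2\frac{p-1}3}\Big(\frac1{t-z_1},\frac1{t-z_2},\frac1{t-z_3}\Big)=\sum_i\bar c^{\,i}(z_1,z_2,z_3)\,t^i,$$ where $\bar c^{\,i}=(\bar c^{\,i}_1,\bar c^{\,i}_2,\bar c^{\,i}_3)$ are vectors of polynomials in $z_1,z_2,z_3$ with integer coefficients. Let $c^i=(c^i_1,c^i_2,c^i_3)\in(\mathbb F_p[z_1,z_2,z_3])^3$ be the reduction of $\bar c^{\,i}$ modulo $p$; here $i$ is a superscript index, and $c^{p-1}_j$ is the $j$-th coordinate of $c^i$ for $i=p-1$. (The vector $\prod_{1\le a<b\le3}(z_a-z_b)^{(p+2)/3}\,(c_1^{p-1},c_2^{p-1},c_3^{p-1})$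 is a solution of the KZ equations modulo $p$ with $\kappa=3$, $n=3$, $m_1=m_2=m_3=2$.) *)

theory Defs
  imports "Berlekamp_Zassenhaus.Finite_Field"
begin

text \<open>
  The prime field with \<open>p\<close> elements is \<open>'p mod_ring\<close> with \<open>'p :: prime_card\<close> and
  \<open>p = CARD('p)\<close>.

  Polynomials in several variables are iterated univariate ones, the innermost type
  belonging to the first variable: \<open>'a poly2\<close> is \<open>'a[t][y]\<close>, where the coefficient of
  \<open>t\<^sup>i y\<^sup>k\<close> is \<open>coeff (coeff F k) i\<close>, and \<open>'a poly3\<close> is
  \<open>'a[X\<^sub>1][X\<^sub>2][X\<^sub>3]\<close>, where the coefficient of \<open>X\<^sub>1\<^sup>i X\<^sub>2\<^sup>k X\<^sub>3\<^sup>l\<close> is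
  \<open>coeff (coeff (coeff G l) k) i\<close>.
\<close>

type_synonym 'a poly2 = "'a poly poly"
type_synonym 'a poly3 = "'a poly poly poly"

definition eval3 :: "'a::comm_ring_1 poly3 \<Rightarrow> 'a \<times> 'a \<times> 'a \<Rightarrow> 'a" where
  "eval3 G q = (case q of (a, b, c) \<Rightarrow> poly (poly (poly G [:[:c:]:]) [:b:]) a)"

definition form :: "nat \<Rightarrow> 'a::comm_ring_1 poly3 \<Rightarrow> bool" where
  "form d G \<longleftrightarrow> (\<forall>i k l. coeff (coeff (coeff G l) k) i \<noteq> 0 \<longrightarrow> i + k + l = d)"

definition tdegree :: "'a::comm_ring_1 poly2 \<Rightarrow> nat" where
  "tdegree F = Max (insert 0 {i + k | i k. coeff (coeff F k) i \<noteq> 0})"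

text \<open>
  \<open>hom_deg m F\<close> is \<open>X\<^sub>3\<^sup>m F(X\<^sub>1/X\<^sub>3, X\<^sub>2/X\<^sub>3)\<close>; it is meant for \<open>m \<ge> tdegree F\<close>.
\<close>

definition hom_deg :: "nat \<Rightarrow> 'a::comm_ring_1 poly2 \<Rightarrow> 'a poly3" where
  "hom_deg m F = (\<Sum>k\<le>degree F. \<Sum>i\<le>degree (coeff F k).
     monom (monom (monom (coeff (coeff F k) i) i) k) (m - i - k))"

definition homogenization :: "'a::comm_ring_1 poly2 \<Rightarrow> 'a poly3" where
  "homogenization F = hom_deg (tdegree F) F"


text \<open>
  A point of the projective plane is the set of all its homogeneous coordinates. The affine
  point \<open>(t, y)\<close> is \<open>proj_point (t, y, 1)\<close>; the line at infinity is \<open>X\<^sub>3 = 0\<close>.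
\<close>

definition proj_point :: "'a::field \<times> 'a \<times> 'a \<Rightarrow> ('a \<times> 'a \<times> 'a) set" where
  "proj_point q = (case q of (a, b, c) \<Rightarrow> {(r * a, r * b, r * c) | r. r \<noteq> 0})"

definition proj_plane :: "('a::field \<times> 'a \<times> 'a) set set" where
  "proj_plane = proj_point ` (UNIV - {(0, 0, 0)})"

text \<open>
  The set of rational points over \<open>'a\<close> of the projective closure of the affine plane curve
  \<open>F = 0\<close>.
\<close>

definition proj_closure :: "'a::field poly2 \<Rightarrow> ('a \<times> 'a \<times> 'a) set set" where
  "proj_closure F = {P \<in> proj_plane. \<forall>q\<in>P. eval3 (homogenization F) q = 0}"

text \<open>
  A rational function on the projective closure of an irreducible curve \<open>F = 0\<close> is an
  equivalence class of fractions \<open>A/B\<close> of forms of equal degree, with \<open>B\<close> not vanishing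
  identically on the curve; \<open>A/B\<close> and \<open>A'/B'\<close> are equivalent if \<open>A B' - A' B\<close> vanishes
  on the curve. The class is represented by the set of its pairs \<open>(A, B)\<close>.
  \<open>ratfun F n d\<close> is the class of the fraction \<open>n/d\<close> of polynomials in the affine
  coordinates \<open>t, y\<close>.
\<close>

definition ratfun_forms :: "'a::field poly2 \<Rightarrow> 'a poly3 \<Rightarrow> 'a poly3 \<Rightarrow> ('a poly3 \<times> 'a poly3) set" where
  "ratfun_forms F G H = {(A, B). (\<exists>e. form e A \<and> form e B) \<and> \<not> homogenization F dvd B \<and>
     homogenization F dvd A * H - G * B}"

definition ratfun :: "'a::field poly2 \<Rightarrow> 'a poly2 \<Rightarrow> 'a poly2 \<Rightarrow> ('a poly3 \<times> 'a poly3) set" where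
  "ratfun F n d = (let m = max (tdegree n) (tdegree d) in
     ratfun_forms F (hom_deg m n) (hom_deg m d))"

definition regular_at :: "('a::field poly3 \<times> 'a poly3) set \<Rightarrow> ('a \<times> 'a \<times> 'a) set \<Rightarrow> bool" where
  "regular_at h P \<longleftrightarrow> (\<exists>(A, B)\<in>h. \<forall>q\<in>P. eval3 B q \<noteq> 0)"

definition value_at :: "('a::field poly3 \<times> 'a poly3) set \<Rightarrow> ('a \<times> 'a \<times> 'a) set \<Rightarrow> 'a" where
  "value_at h P = (THE v. \<exists>(A, B)\<in>h. \<forall>q\<in>P. eval3 B q \<noteq> 0 \<and> v = eval3 A q / eval3 B q)"

definition curve_integral :: "'a::{field,finite} poly2 \<Rightarrow> ('a poly3 \<times> 'a poly3) set \<Rightarrow> 'a" where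
  "curve_integral F h = (\<Sum>P\<in>{P \<in> proj_closure F. regular_at h P}. value_at h P)"


text \<open>\<open>y\<^sup>3 - (t - x\<^sub>1)(t - x\<^sub>2)(t - x\<^sub>3)\<close> and \<open>t - a\<close> in \<open>'a[t][y]\<close>\<close>

definition cubic :: "(nat \<Rightarrow> 'a::comm_ring_1) \<Rightarrow> 'a poly2" where
  "cubic x = [:0, 1:] ^ 3 - [:\<Prod>s\<in>{1,2,3}. [:- x s, 1:]:]"

definition t_minus :: "'a::comm_ring_1 \<Rightarrow> 'a poly2" where
  "t_minus a = [:[:- a, 1:]:]"


text \<open>The variables \<open>z\<^sub>1, z\<^sub>2, z\<^sub>3\<close>, for the indices 1, 2, 3\<close>

definition zvar :: "nat \<Rightarrow> 'a::comm_ring_1 poly3" where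
  "zvar s = (if s = 1 then [:[:[:0, 1:]:]:] else if s = 2 then [:[:0, 1:]:] else [:0, 1:])"

text \<open>
  \<open>cbar p i j\<close> is the coefficient of \<open>t\<^sup>i\<close> in the \<open>j\<close>-th coordinate of the expanded vector.
  \<open>cred p i j\<close> is its reduction modulo \<open>p = CARD('p)\<close>. For \<open>p > 1\<close> with \<open>3\<close> dividing \<open>p - 1\<close> the polynomial division is exact.
\<close>

definition cbar :: "nat \<Rightarrow> nat \<Rightarrow> nat \<Rightarrow> int poly3" where
  "cbar p i j = coeff ((\<Prod>s\<in>{1,2,3}. [:- zvar s, 1:] ^ (2 * ((p - 1) div 3))) div [:- zvar j, 1:]) i"

definition cred :: "nat \<Rightarrow> nat \<Rightarrow> nat \<Rightarrow> 'p::prime_card mod_ring poly3" where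
  "cred p i j = map_poly (map_poly (map_poly of_int)) (cbar p i j)"

end

theory Submission
  imports Defs
begin

text \<open>
  Write \<open>f(t) = (t - x\<^sub>1)(t - x\<^sub>2)(t - x\<^sub>3)\<close> and \<open>p - 1 = 3m\<close>. The function \<open>1/(t - x\<^sub>j)\<close> is
  the fraction \<open>X\<^sub>3/(X\<^sub>1 - x\<^sub>j X\<^sub>3)\<close>, which vanishes at the points at infinity. At the single
  point over \<open>t = x\<^sub>j\<close> it has a pole: its denominator vanishes there and its numerator does
  not, so no equivalent fraction is defined there either. Hence the integral is the
  sum of \<open>N(f(t))/(t - x\<^sub>j)\<close> over \<open>t \<noteq> x\<^sub>j\<close>, where \<open>N(a)\<close> is the number of cube roots of \<open>a\<close>
  in the field (\<open>curve_integral_affine\<close>).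

  In the field itself, \<open>N(a) = 1 + a\<^sup>m + a\<^bsup>2m\<^esup>\<close> (\<open>of_nat_card_roots\<close>). This turns the integral
  into three sums of values of polynomials. The sum of \<open>t\<^sup>i\<close> over all \<open>t\<close> is \<open>-1\<close> if \<open>i\<close> is
  a positive multiple of \<open>p - 1\<close>, and \<open>0\<close> otherwise (\<open>sum_powers\<close>), so summing the values of
  a polynomial of degree below \<open>2(p - 1)\<close> extracts minus its coefficient at \<open>t\<^bsup>p-1\<^esup>\<close>. The
  summand \<open>1\<close> of \<open>N\<close> contributes the sum of all inverses, which is \<open>0\<close>. The polynomial
  \<open>f\<^sup>m/(t - x\<^sub>j)\<close> has degree \<open>p - 2\<close> and contributes \<open>0\<close> as well. The polynomial
  \<open>f\<^bsup>2m\<^esup>/(t - x\<^sub>j)\<close> contributes minus its coefficient at \<open>t\<^bsup>p-1\<^esup>\<close>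
  (\<open>sum_card_cube_roots_over_linear\<close>), and this coefficient is the specialization at
  \<open>z = x\<close> of the polynomial \<open>c\<^sub>j\<^bsup>p-1\<^esup>\<close> (\<open>eval3_cred\<close>).
\<close>

section \<open>Power sums over a finite field\<close>

text \<open>
  The translation \<open>x \<mapsto> x + 1\<close> permutes the field, so it does not change the sum of all elements.
\<close>

lemma of_nat_card_UNIV_eq_0: "of_nat CARD('a::{field,finite}) = (0::'a)"
proof -
  have "(\<Sum>x\<in>UNIV. x + 1) = (\<Sum>x\<in>UNIV. x::'a)"
    by (rule sum.reindex_bij_witness[of _ "\<lambda>x. x - 1" "\<lambda>x. x + 1"]) auto
  then show ?thesis by (simp add: sum.distrib)
qed

lemma card_UNIV_field_gt_1: "CARD('a::{field,finite}) > 1"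
proof -
  have "card {0::'a, 1} \<le> CARD('a)" by (rule card_mono) auto
  then show ?thesis by simp
qed

text \<open>
  Multiplication by \<open>x\<close> permutes the nonzero elements, so it does not change their product.
\<close>

lemma power_card_minus_1:
  fixes x :: "'a::{field,finite}"
  assumes "x \<noteq> 0"
  shows "x ^ (CARD('a) - 1) = 1"
proof -
  have "(\<Prod>y\<in>UNIV - {0}. x * y) = (\<Prod>y\<in>UNIV - {0}. y)"
    by (rule prod.reindex_bij_witness[of _ "\<lambda>y. y / x" "\<lambda>y. x * y"]) (use assms in auto)
  then have "x ^ card (UNIV - {0::'a}) * (\<Prod>y\<in>UNIV - {0}. y) = (\<Prod>y\<in>UNIV - {0}. y)"
    by (simp add: prod.distrib)
  moreover have "(\<Prod>y\<in>UNIV - {0::'a}. y) \<noteq> 0" by simp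
  ultimately show ?thesis by (simp add: card_Diff_singleton)
qed

lemma power_card:
  fixes x :: "'a::{field,finite}"
  shows "x ^ CARD('a) = x"
proof (cases "x = 0")
  case False
  have "x ^ CARD('a) = x * x ^ (CARD('a) - 1)"
    using card_UNIV_field_gt_1[where 'a='a] by (metis power_eq_if not_less0)
  then show ?thesis using power_card_minus_1[OF False] by simp
qed (use card_UNIV_field_gt_1[where 'a='a] in \<open>simp add: power_0_left\<close>)

text \<open>
  Reducing \<open>i\<close> modulo \<open>CARD('a) - 1\<close> gives a positive exponent \<open>r < CARD('a) - 1\<close>, and \<open>X\<^sup>r - 1\<close>
  has too few roots to vanish at every nonzero element.
\<close>

lemma exists_power_neq_1:
  assumes "\<not> (CARD('a::{field,finite}) - 1) dvd i"
  shows "\<exists>g::'a. g \<noteq> 0 \<and> g ^ i \<noteq> 1"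
proof (rule ccontr)
  let ?n = "CARD('a) - 1"
  assume "\<not> ?thesis"
  then have all1: "g ^ i = 1" if "g \<noteq> 0" for g :: 'a using that by blast
  define r where "r = i mod ?n"
  have r: "0 < r" "r < ?n"
    using assms card_UNIV_field_gt_1[where 'a='a] by (auto simp: r_def mod_greater_zero_iff_not_dvd)
  have "g ^ r = 1" if "g \<noteq> 0" for g :: 'a
  proof -
    have "g ^ i = g ^ (?n * (i div ?n) + r)" by (simp add: r_def)
    also have "\<dots> = g ^ r" by (simp only: power_add power_mult power_card_minus_1[OF that]) simp
    finally show ?thesis using all1[OF that] by simp
  qed
  then have sub: "UNIV - {0} \<subseteq> {g::'a. poly (monom 1 r - 1) g = 0}" by (auto simp: poly_monom)
  have nz: "monom 1 r - 1 \<noteq> (0::'a poly)"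
  proof
    assume "monom 1 r - 1 = (0::'a poly)"
    then have "coeff (monom 1 r - 1) 0 = (0::'a)" by simp
    then show False using r by simp
  qed
  have "?n = card (UNIV - {0::'a})" by (simp add: card_Diff_singleton)
  also have "\<dots> \<le> card {g::'a. poly (monom 1 r - 1) g = 0}"
    by (rule card_mono[OF _ sub]) simp
  also have "\<dots> \<le> degree (monom 1 r - 1 :: 'a poly)" by (rule card_poly_roots_bound[OF nz])
  also have "\<dots> \<le> r" by (intro degree_diff_le) (auto simp: degree_monom_le)
  finally show False using r by simp
qed

text \<open>
  In the case of the value \<open>0\<close> with \<open>i \<noteq> 0\<close>, substituting \<open>g x\<close> for \<open>x\<close> multiplies the sum by
  \<open>g\<^sup>i \<noteq> 1\<close> without changing it. For \<open>i = 0\<close>, the convention \<open>0 ^ 0 = 1\<close> makes the sum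
  the number of all elements, not only of the nonzero ones.
\<close>

lemma sum_powers:
  "(\<Sum>x\<in>UNIV. x ^ i) = (if i \<noteq> 0 \<and> (CARD('a) - 1) dvd i then - 1 else (0::'a::{field,finite}))"
proof -
  consider "i = 0" | "i \<noteq> 0" "(CARD('a) - 1) dvd i" | "\<not> (CARD('a) - 1) dvd i" by auto
  then show ?thesis
  proof cases
    case 1
    then show ?thesis by (simp add: of_nat_card_UNIV_eq_0)
  next
    case 2
    then obtain k where k: "i = (CARD('a) - 1) * k" by auto
    have "x ^ i = 1" if "x \<noteq> 0" for x :: 'a
      unfolding k power_mult power_card_minus_1[OF that] by simp
    then have "(\<Sum>x\<in>UNIV. x ^ i) = (\<Sum>x\<in>UNIV - {0::'a}. 1::'a)"
      using 2 by (intro sum.mono_neutral_cong_right) (auto simp: power_0_left)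
    also have "\<dots> = of_nat CARD('a) - 1"
      using card_UNIV_field_gt_1[where 'a='a] by (simp add: card_Diff_singleton of_nat_diff)
    finally show ?thesis using 2 by (simp add: of_nat_card_UNIV_eq_0)
  next
    case 3
    then obtain g :: 'a where g: "g \<noteq> 0" "g ^ i \<noteq> 1" using exists_power_neq_1 by blast
    have "(\<Sum>x\<in>UNIV. (g * x) ^ i) = (\<Sum>x\<in>UNIV. x ^ i)"
      by (rule sum.reindex_bij_witness[of _ "\<lambda>y. y / g" "\<lambda>y. g * y"]) (use g in auto)
    then have "(g ^ i - 1) * (\<Sum>x\<in>UNIV. x ^ i) = 0"
      by (simp add: power_mult_distrib left_diff_distrib flip: sum_distrib_left)
    then show ?thesis using g 3 by simp
  qed
qed

lemma sum_poly_UNIV: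
  fixes f :: "'a::{field,finite} poly"
  assumes "degree f < 2 * (CARD('a) - 1)"
  shows "(\<Sum>x\<in>UNIV. poly f x) = - coeff f (CARD('a) - 1)"
proof -
  let ?n = "CARD('a) - 1"
  have n: "?n > 0" using card_UNIV_field_gt_1[where 'a='a] by simp
  have iff: "i \<noteq> 0 \<and> ?n dvd i \<longleftrightarrow> i = ?n" if "i < 2 * ?n" for i
  proof
    assume a: "i \<noteq> 0 \<and> ?n dvd i"
    then obtain k where k: "i = ?n * k" by auto
    with a that have "k < 2" "k \<noteq> 0" by auto
    then have "k = 1" by simp
    with k show "i = ?n" by simp
  qed (use n in auto)
  have "(\<Sum>x\<in>UNIV. poly f x) = (\<Sum>x\<in>UNIV. \<Sum>i<2 * ?n. coeff f i * x ^ i)"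
  proof (rule sum.cong[OF refl])
    fix x
    show "poly f x = (\<Sum>i<2 * ?n. coeff f i * x ^ i)"
      unfolding poly_altdef
      by (rule sum.mono_neutral_left) (use assms in \<open>auto simp: coeff_eq_0\<close>)
  qed
  also have "\<dots> = (\<Sum>i<2 * ?n. coeff f i * (\<Sum>x\<in>UNIV. x ^ i))"
    by (subst sum.swap) (simp add: sum_distrib_left)
  also have "\<dots> = (\<Sum>i<2 * ?n. if i = ?n then - coeff f i else 0)"
    by (rule sum.cong[OF refl]) (use iff in \<open>auto simp: sum_powers\<close>)
  also have "\<dots> = - coeff f ?n" using n by simp
  finally show ?thesis .
qed

text \<open>
  The sum on the right is \<open>(u\<^sup>q - a\<^sup>q)/(u - a)\<close> with \<open>q = CARD('a)\<close>. For \<open>u \<noteq> a\<close> it is \<open>1\<close>, because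
  \<open>u\<^sup>q = u\<close> and \<open>a\<^sup>q = a\<close>; for \<open>u = a\<close> it has \<open>q\<close> equal terms.
\<close>

lemma of_bool_eq_sum_powers:
  fixes u a :: "'a::{field,finite}"
  shows "of_bool (u = a) = 1 - (\<Sum>k<CARD('a). a ^ (CARD('a) - Suc k) * u ^ k)"
proof (cases "u = a")
  case True
  have "(\<Sum>k<CARD('a). a ^ (CARD('a) - Suc k) * a ^ k) = (\<Sum>k<CARD('a). a ^ (CARD('a) - 1))"
    by (rule sum.cong) (auto simp flip: power_add)
  then show ?thesis using True by (simp add: of_nat_card_UNIV_eq_0)
next
  case False
  have "u - a = (u - a) * (\<Sum>k<CARD('a). a ^ (CARD('a) - Suc k) * u ^ k)"
    using power_diff_sumr2[of u "CARD('a)" a] by (simp add: power_card)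
  then show ?thesis using False by simp
qed

text \<open>
  Solutions are counted by summing the polynomial indicator of \<open>y\<^sup>d = a\<close> over all \<open>y\<close>. After
  exchanging the sums, the power sums over \<open>y\<close> keep only the exponents
  \<open>k\<close> that are positive multiples of \<open>m\<close>. The term \<open>i = 0\<close> is \<open>1\<close> also for \<open>a = 0\<close>, which accounts for the single root \<open>y = 0\<close> in that case.
\<close>

lemma of_nat_card_roots:
  fixes a :: "'a::{field,finite}"
  assumes dm: "CARD('a) - 1 = d * m"
  shows "of_nat (card {y. y ^ d = a}) = (\<Sum>i<d. a ^ (i * m))"
proof -
  let ?q = "CARD('a)"
  have pos: "d > 0" "m > 0" "?q = Suc (d * m)"
    using dm card_UNIV_field_gt_1[where 'a='a] by (auto intro!: gr0I)
  have "of_nat (card {y. y ^ d = a}) = (\<Sum>y\<in>UNIV. of_bool (y ^ d = a) :: 'a)"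
    by (simp add: of_bool_def sum.If_cases)
  also have "\<dots> = (\<Sum>y\<in>UNIV. 1 - (\<Sum>k<?q. a ^ (?q - Suc k) * (y ^ d) ^ k))"
    by (simp only: of_bool_eq_sum_powers)
  also have "\<dots> = - (\<Sum>k<?q. a ^ (?q - Suc k) * (\<Sum>y\<in>UNIV. y ^ (d * k)))"
    by (subst sum_subtractf, subst sum.swap)
      (simp add: of_nat_card_UNIV_eq_0 sum_distrib_left power_mult)
  also have "\<dots> = (\<Sum>k<?q. if k \<noteq> 0 \<and> m dvd k then a ^ (?q - Suc k) else 0)"
    using pos dm by (subst sum_negf[symmetric], intro sum.cong) (auto simp: sum_powers)
  also have "\<dots> = (\<Sum>k\<in>{k\<in>{..<?q}. k \<noteq> 0 \<and> m dvd k}. a ^ (?q - Suc k))"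
    by (rule sum.inter_filter[symmetric]) simp
  also have "\<dots> = (\<Sum>i<d. a ^ (i * m))"
  proof (rule sum.reindex_bij_witness[of _ "\<lambda>i. (d - i) * m" "\<lambda>k. d - k div m"])
    fix k assume "k \<in> {k \<in> {..<?q}. k \<noteq> 0 \<and> m dvd k}"
    then obtain l where l: "k = m * l" "l \<noteq> 0" "m * l \<le> d * m" using pos by (auto elim!: dvdE simp: less_Suc_eq_le)
    then have "l \<le> d" using pos by (simp add: mult.commute)
    with l pos show "(d - (d - k div m)) * m = k" "d - k div m \<in> {..<d}"
      "a ^ ((d - k div m) * m) = a ^ (?q - Suc k)"
      by (simp_all add: diff_mult_distrib mult.commute[of m])
  next
    fix i assume "i \<in> {..<d}"
    with pos show "d - (d - i) * m div m = i" "(d - i) * m \<in> {k \<in> {..<?q}. k \<noteq> 0 \<and> m dvd k}"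
      by (auto simp: less_Suc_eq_le)
  qed
  finally show ?thesis .
qed

text \<open>
  Since \<open>k \<ge> 2\<close>, the polynomial \<open>f\<^sup>k/(X - a) = g f\<^bsup>k-1\<^esup>\<close> vanishes at \<open>a\<close>, so the sum may be
  extended to all elements of the field.
\<close>

lemma sum_power_over_linear:
  fixes a :: "'a::{field,finite}" and g :: "'a poly"
  defines "f \<equiv> [:- a, 1:] * g"
  assumes k: "k \<ge> 2" and deg: "k * degree f \<le> 2 * (CARD('a) - 1)"
  shows "(\<Sum>t\<in>UNIV - {a}. poly f t ^ k / (t - a)) = - coeff (g * f ^ (k - 1)) (CARD('a) - 1)"
proof -
  have kk: "k = Suc (k - 1)" using k by simp
  have fk: "[:- a, 1:] * (g * f ^ (k - 1)) = f ^ k"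
    by (subst kk, unfold power_Suc) (simp add: f_def algebra_simps)
  have "(\<Sum>t\<in>UNIV - {a}. poly f t ^ k / (t - a)) = (\<Sum>t\<in>UNIV. poly (g * f ^ (k - 1)) t)"
  proof (rule sum.mono_neutral_cong_left)
    fix t assume t: "t \<in> UNIV - {a}"
    have "poly ([:- a, 1:] * (g * f ^ (k - 1))) t = poly f t ^ k" by (simp only: fk poly_power)
    then have "(t - a) * poly (g * f ^ (k - 1)) t = poly f t ^ k"
      by (simp only: poly_mult[of "[:- a, 1:]"]) simp
    then show "poly f t ^ k / (t - a) = poly (g * f ^ (k - 1)) t" using t
      by (simp add: divide_eq_eq mult.commute)
  next
    show "\<forall>i\<in>UNIV - (UNIV - {a}). poly (g * f ^ (k - 1)) i = 0"
      using k by (auto simp: f_def)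
  qed auto
  also have "\<dots> = - coeff (g * f ^ (k - 1)) (CARD('a) - 1)"
  proof (cases "g * f ^ (k - 1) = 0")
    case True
    show ?thesis unfolding True by simp
  next
    case False
    have "Suc (degree (g * f ^ (k - 1))) = degree (f ^ k)"
      unfolding fk[symmetric] using False by (subst degree_mult_eq) auto
    also have "\<dots> \<le> 2 * (CARD('a) - 1)" using degree_power_le[of f k] deg by (simp add: mult.commute)
    finally show ?thesis by (intro sum_poly_UNIV) simp
  qed
  finally show ?thesis .
qed

text \<open>
  The three summands of the number of cube roots are treated separately. The one with exponent \<open>m\<close>
  belongs to a polynomial of degree \<open>3m - 1\<close>, which has no coefficient at \<open>t\<^bsup>3m\<^esup>\<close>.
\<close>

lemma sum_card_cube_roots_over_linear:
  fixes a :: "'a::{field,finite}" and g :: "'a poly"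
  defines "f \<equiv> [:- a, 1:] * g"
  assumes q: "CARD('a) - 1 = 3 * m" and m: "m \<ge> 2" and deg: "degree f = 3"
  shows "(\<Sum>t\<in>UNIV - {a}. of_nat (card {y. y ^ 3 = poly f t}) / (t - a))
    = - coeff (g * f ^ (2 * m - 1)) (CARD('a) - 1)"
proof -
  have f0: "f \<noteq> 0" and g0: "g \<noteq> 0" using deg by (auto simp: f_def)
  have dg: "degree g = 2" using deg g0 unfolding f_def by (subst (asm) degree_mult_eq) auto
  have inv: "(\<Sum>t\<in>UNIV - {a}. 1 / (t - a)) = 0"
  proof -
    have "(\<Sum>t\<in>UNIV - {a}. 1 / (t - a)) = (\<Sum>u\<in>UNIV - {0::'a}. u)"
      by (rule sum.reindex_bij_witness[of _ "\<lambda>u. a + 1 / u" "\<lambda>t. 1 / (t - a)"]) auto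
    also have "\<dots> = (\<Sum>u\<in>UNIV. u ^ 1)" by (rule sum.mono_neutral_cong_left) auto
    also have "\<dots> = 0" using q m by (subst sum_powers) auto
    finally show ?thesis .
  qed
  have mid: "(\<Sum>t\<in>UNIV - {a}. poly f t ^ m / (t - a)) = 0"
  proof -
    have "degree (g * f ^ (m - 1)) < CARD('a) - 1"
      using f0 g0 m by (simp only: q, subst degree_mult_eq) (auto simp: degree_power_eq deg dg)
    then have "coeff (g * f ^ (m - 1)) (CARD('a) - 1) = 0" by (rule coeff_eq_0)
    with sum_power_over_linear[of m a g, folded f_def] m deg q show ?thesis by simp
  qed
  have top: "(\<Sum>t\<in>UNIV - {a}. poly f t ^ (2 * m) / (t - a))
      = - coeff (g * f ^ (2 * m - 1)) (CARD('a) - 1)"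
    using sum_power_over_linear[of "2 * m" a g, folded f_def] m deg q by simp
  have "of_nat (card {y. y ^ 3 = poly f t}) / (t - a)
      = 1 / (t - a) + poly f t ^ m / (t - a) + poly f t ^ (2 * m) / (t - a)" for t
    by (simp add: of_nat_card_roots[OF q] lessThan_nat_numeral add_divide_distrib)
  then show ?thesis using inv mid top by (simp add: sum.distrib)
qed

section \<open>Evaluation of forms and values of rational functions\<close>

lemma eval3_ring_hom [simp]:
  "eval3 0 q = 0" "eval3 1 q = 1"
  "eval3 (A + B) q = eval3 A q + eval3 B q" "eval3 (A - B) q = eval3 A q - eval3 B q"
  "eval3 (A * B) q = eval3 A q * eval3 B q"
  by (cases q; simp add: eval3_def)+

lemma eval3_monom [simp]:
  "eval3 (monom (monom (monom u i) k) l) (a, b, c) = u * a ^ i * b ^ k * c ^ l"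
  by (simp add: eval3_def poly_monom poly_const_pow)

lemma eval3_dvd: "A dvd B \<Longrightarrow> eval3 A q = 0 \<Longrightarrow> eval3 B q = 0"
  by (auto elim!: dvdE)

text \<open>
  At a point of the curve, a representative may be compared with the given fraction by
  cross-multiplication, whether or not the denominators vanish there. This determines the value
  at regular points and detects poles.
\<close>

lemma ratfun_forms_cross_mult:
  assumes "(A, B) \<in> ratfun_forms F G H" "eval3 (homogenization F) q = 0"
  shows "eval3 A q * eval3 H q = eval3 G q * eval3 B q"
  using assms eval3_dvd[of "homogenization F" "A * H - G * B" q] by (auto simp: ratfun_forms_def)

lemma proj_closure_point:
  assumes "P \<in> proj_closure F"
  obtains q where "q \<in> P" "\<And>q. q \<in> P \<Longrightarrow> eval3 (homogenization F) q = 0"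
proof -
  obtain a b c where "P = proj_point (a, b, c)" using assms
    by (auto simp: proj_closure_def proj_plane_def)
  then have "(1 * a, 1 * b, 1 * c) \<in> P" unfolding proj_point_def by (auto intro!: exI[of _ 1])
  then show ?thesis using that assms by (auto simp: proj_closure_def)
qed

text \<open>
  The value is taken as a constant \<open>v\<close> on all homogeneous coordinates of \<open>P\<close>, since this is what
  the definition of \<open>value_at\<close> asks of a representative. Uniqueness follows by comparing two
  representatives at one choice of coordinates.
\<close>

lemma regular_at_value_at:
  assumes "(G, H) \<in> ratfun_forms F G H" and P: "P \<in> proj_closure F"
    and v: "\<And>q. q \<in> P \<Longrightarrow> eval3 H q \<noteq> 0 \<and> v = eval3 G q / eval3 H q"
  shows "regular_at (ratfun_forms F G H) P" "value_at (ratfun_forms F G H) P = v"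
proof -
  obtain q where q: "q \<in> P" "eval3 (homogenization F) q = 0" using proj_closure_point[OF P] by metis
  show "regular_at (ratfun_forms F G H) P" using assms unfolding regular_at_def by blast
  show "value_at (ratfun_forms F G H) P = v" unfolding value_at_def
  proof (rule the_equality)
    show "\<exists>(A, B)\<in>ratfun_forms F G H. \<forall>q\<in>P. eval3 B q \<noteq> 0 \<and> v = eval3 A q / eval3 B q"
      using assms by blast
  next
    fix w assume "\<exists>(A, B)\<in>ratfun_forms F G H. \<forall>q\<in>P. eval3 B q \<noteq> 0 \<and> w = eval3 A q / eval3 B q"
    then obtain A B where AB: "(A, B) \<in> ratfun_forms F G H" "eval3 B q \<noteq> 0"
      "w = eval3 A q / eval3 B q" using q by blast
    show "w = v" using ratfun_forms_cross_mult[OF AB(1) q(2)] AB(2,3) v[OF q(1)]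
      by (simp add: frac_eq_eq mult.commute)
  qed
qed

text \<open>
  If \<open>A/B\<close> is equivalent to \<open>G/H\<close>, then \<open>A H = G B\<close> at \<open>q\<close>. There \<open>H = 0\<close> and \<open>G \<noteq> 0\<close>, so every
  possible denominator \<open>B\<close> vanishes.
\<close>

lemma not_regular_at:
  assumes P: "P \<in> proj_closure F" and q: "q \<in> P" "eval3 H q = 0" "eval3 G q \<noteq> 0"
  shows "\<not> regular_at (ratfun_forms F G H) P"
proof
  assume "regular_at (ratfun_forms F G H) P"
  then obtain A B where AB: "(A, B) \<in> ratfun_forms F G H" "eval3 B q \<noteq> 0"
    using q unfolding regular_at_def by blast
  have "eval3 (homogenization F) q = 0" using P q by (auto simp: proj_closure_def)
  from ratfun_forms_cross_mult[OF AB(1) this] AB q show False by simp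
qed

section \<open>The projective cubic\<close>

lemma tdegree_eqI:
  assumes "\<And>i k. coeff (coeff F k) i \<noteq> 0 \<Longrightarrow> i + k \<le> d" "coeff (coeff F l) j \<noteq> 0" "j + l = d"
  shows "tdegree F = d"
  unfolding tdegree_def
proof (rule Max_eqI)
  show "finite (insert 0 {i + k |i k. coeff (coeff F k) i \<noteq> 0})"
    by (rule finite_subset[of _ "{..d}"]) (use assms in auto)
  show "d \<in> insert 0 {i + k |i k. coeff (coeff F k) i \<noteq> 0}" using assms by auto
qed (use assms in auto)

lemma hom_deg_one: "hom_deg (Suc 0) (1::'a::field poly2) = monom (monom (monom 1 0) 0) 1"
  by (simp add: hom_deg_def)

lemma hom_deg_t_minus: "hom_deg (Suc 0) (t_minus (a::'a::field))
    = monom (monom (monom (- a) 0) 0) 1 + monom (monom (monom 1 1) 0) 0"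
  by (simp add: hom_deg_def t_minus_def)

lemma tdegree_one: "tdegree (1::'a::field poly2) = 0"
  by (rule tdegree_eqI[where l=0 and j=0]) (auto simp: coeff_1 of_bool_def split: if_splits)

lemma tdegree_t_minus: "tdegree (t_minus (a::'a::field)) = 1"
  by (rule tdegree_eqI[where l=0 and j=1])
    (auto simp: t_minus_def coeff_pCons split: nat.splits)

lemma prod_linear_expand: "(\<Prod>s\<in>{1,2,3}. [:- x s, 1:]) = [:- (x 1 * x 2 * x 3),
    x 1 * x 2 + x 1 * x 3 + x 2 * x 3, - (x 1 + x 2 + x 3), 1:]" for x :: "nat \<Rightarrow> 'a::comm_ring_1"
  by (simp add: algebra_simps)

lemma cubic_expand: "cubic x = [:[:x 1 * x 2 * x 3,
    - (x 1 * x 2 + x 1 * x 3 + x 2 * x 3), x 1 + x 2 + x 3, - 1:], 0, 0, 1::'a::comm_ring_1 poly:]"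
  unfolding cubic_def prod_linear_expand by (simp add: power3_eq_cube)

lemma tdegree_cubic: "tdegree (cubic (x::nat \<Rightarrow> 'a::field)) = 3"
  by (rule tdegree_eqI[where l=3 and j=0])
    (auto simp: cubic_expand coeff_pCons eval_nat_numeral one_pCons split: nat.splits)

lemma eval3_homogenization_cubic:
  "eval3 (homogenization (cubic (x::nat \<Rightarrow> 'a::field))) (a, b, c)
    = b ^ 3 - (a - x 1 * c) * (a - x 2 * c) * (a - x 3 * c)"
proof -
  have expand: "eval3 (hom_deg 3 [:[:e0, e1, e2, - 1:], 0, 0, 1:]) (a, b, c)
      = b ^ 3 - a ^ 3 + e2 * a ^ 2 * c + e1 * a * c ^ 2 + e0 * c ^ 3" for e0 e1 e2 :: 'a
    by (simp add: hom_deg_def eval_nat_numeral eval3_def poly_monom)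
  then show ?thesis
    unfolding homogenization_def tdegree_cubic unfolding cubic_expand
    by (simp only: expand) (simp add: power2_eq_square power3_eq_cube algebra_simps)
qed

definition affine_point :: "'a::field \<times> 'a \<Rightarrow> ('a \<times> 'a \<times> 'a) set" where
  "affine_point = (\<lambda>(t, y). proj_point (t, y, 1))"

lemma inj_affine_point: "inj affine_point"
proof (rule injI)
  fix v w :: "'a \<times> 'a" assume eq: "affine_point v = affine_point w"
  obtain t y where v: "v = (t, y)" by fastforce
  obtain t' y' where w: "w = (t', y')" by fastforce
  have "(t, y, 1) \<in> affine_point v" unfolding v affine_point_def proj_point_def
    by (auto intro!: exI[of _ 1])
  then have "(t, y, 1) \<in> affine_point w" using eq by simp
  then show "v = w" by (auto simp: v w affine_point_def proj_point_def)
qed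

lemma ratfun_inverse_linear:
  "ratfun (cubic x) 1 (t_minus a) = ratfun_forms (cubic x) (hom_deg 1 1) (hom_deg 1 (t_minus (a::'a::field)))"
  by (simp add: ratfun_def tdegree_one tdegree_t_minus Let_def)

lemma hom_deg_in_ratfun_forms:
  "(hom_deg 1 1, hom_deg 1 (t_minus a)) \<in>
    ratfun_forms (cubic x) (hom_deg 1 1) (hom_deg 1 (t_minus (a::'a::field)))"
proof -
  have "form 1 (hom_deg 1 (1::'a poly2))"
    by (auto simp: form_def hom_deg_one coeff_monom split: if_splits)
  moreover have "form 1 (hom_deg 1 (t_minus a))"
    by (auto simp: form_def hom_deg_t_minus coeff_monom split: if_splits)
  \<comment> \<open>The point at infinity \<open>(1 : 1 : 0)\<close> lies on the curve, and the denominator is \<open>1\<close> there.\<close>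
  moreover have "\<not> homogenization (cubic x) dvd hom_deg 1 (t_minus a)"
    using eval3_dvd[of "homogenization (cubic x)" "hom_deg 1 (t_minus a)" "(1, 1, 0)"]
    by (auto simp: eval3_homogenization_cubic hom_deg_t_minus)
  ultimately show ?thesis by (auto simp: ratfun_forms_def)
qed

text \<open>
  The points at infinity are kept in the domain of integration but contribute \<open>0\<close>.
  They are the only regular points outside the affine part with \<open>t \<noteq> x j\<close>, because an affine
  point over \<open>x j\<close> is a pole.
\<close>

lemma curve_integral_affine:
  fixes x :: "nat \<Rightarrow> 'a::{field,finite}"
  assumes j: "j \<in> {1, 2, 3}"
  defines "f \<equiv> \<Prod>s\<in>{1, 2, 3}. [:- x s, 1:]"
  shows "curve_integral (cubic x) (ratfun (cubic x) 1 (t_minus (x j)))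
    = (\<Sum>t\<in>UNIV - {x j}. of_nat (card {y. y ^ 3 = poly f t}) / (t - x j))"
proof -
  let ?F = "cubic x" and ?a = "x j"
  let ?h = "ratfun ?F 1 (t_minus ?a)"
  let ?S = "{P \<in> proj_closure ?F. regular_at ?h P}"
  define T where "T = (SIGMA t:UNIV - {?a}. {y. y ^ 3 = poly f t})"
  have evalG: "eval3 (hom_deg 1 1) (a, b, c) = c" for a b c :: 'a
    unfolding One_nat_def hom_deg_one eval3_monom by simp
  have evalH: "eval3 (hom_deg 1 (t_minus ?a)) (a, b, c) = a - ?a * c" for a b c
    by (simp add: hom_deg_t_minus)
  have pf: "poly f t = (t - x 1) * (t - x 2) * (t - x 3)" for t
    by (simp add: f_def algebra_simps)
  have val: "regular_at ?h (proj_point (a, b, c)) \<and> value_at ?h (proj_point (a, b, c)) = c / (a - ?a * c)"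
    if P: "proj_point (a, b, c) \<in> proj_closure ?F" and nz: "a - ?a * c \<noteq> 0" for a b c
  proof -
    have "eval3 (hom_deg 1 (t_minus ?a)) q \<noteq> 0 \<and>
        c / (a - ?a * c) = eval3 (hom_deg 1 1) q / eval3 (hom_deg 1 (t_minus ?a)) q"
      if "q \<in> proj_point (a, b, c)" for q
    proof -
      obtain r where r: "q = (r * a, r * b, r * c)" "r \<noteq> 0"
        using \<open>q \<in> _\<close> by (auto simp: proj_point_def)
      have "r * a - ?a * (r * c) = r * (a - ?a * c)" by (simp add: algebra_simps)
      then show ?thesis using r nz by (simp only: r(1) evalG evalH) simp
    qed
    note h = regular_at_value_at[OF hom_deg_in_ratfun_forms P, of _ "c / (a - ?a * c)", OF this]
    show ?thesis unfolding ratfun_inverse_linear using h by (rule conjI)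
  qed
  have on_curve: "affine_point (t, y) \<in> proj_closure ?F \<longleftrightarrow> y ^ 3 = poly f t" for t y
  proof
    assume "affine_point (t, y) \<in> proj_closure ?F"
    moreover have "(t, y, 1) \<in> affine_point (t, y)"
      by (auto simp: affine_point_def proj_point_def intro!: exI[of _ 1])
    ultimately have "eval3 (homogenization ?F) (t, y, 1) = 0" by (auto simp: proj_closure_def)
    then show "y ^ 3 = poly f t" by (simp add: eval3_homogenization_cubic pf)
  next
    assume y: "y ^ 3 = poly f t"
    have "eval3 (homogenization ?F) (r * t, r * y, r * 1) = 0" for r
    proof -
      have "eval3 (homogenization ?F) (r * t, r * y, r * 1) = r ^ 3 * (y ^ 3 - poly f t)"
        by (simp add: eval3_homogenization_cubic pf power3_eq_cube algebra_simps)
      then show ?thesis using y by simp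
    qed
    then have "eval3 (homogenization ?F) q = 0" if "q \<in> affine_point (t, y)" for q
      using that unfolding affine_point_def proj_point_def by auto
    moreover have "affine_point (t, y) \<in> proj_plane"
      unfolding affine_point_def proj_plane_def by auto
    ultimately show "affine_point (t, y) \<in> proj_closure ?F" by (auto simp: proj_closure_def)
  qed
  have sub: "affine_point ` T \<subseteq> ?S"
  proof
    fix P assume "P \<in> affine_point ` T"
    then obtain t y where P: "P = affine_point (t, y)" "t \<noteq> ?a" "y ^ 3 = poly f t"
      by (auto simp: T_def)
    then show "P \<in> ?S" using val[of t y 1] on_curve[of t y] by (auto simp: affine_point_def)
  qed
  have zero: "value_at ?h P = 0" if "P \<in> ?S - affine_point ` T" for P
  proof -
    have S: "P \<in> proj_closure ?F" "regular_at ?h P" using that by auto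
    then obtain a b c where P: "P = proj_point (a, b, c)" and nz: "(a, b, c) \<noteq> (0, 0, 0)"
      by (auto simp: proj_closure_def proj_plane_def)
    have in_P: "(r * a, r * b, r * c) \<in> P" if "r \<noteq> 0" for r
      using that by (auto simp: P proj_point_def)
    have curve: "eval3 (homogenization ?F) (a, b, c) = 0"
      using in_P[of 1] S by (auto simp: proj_closure_def)
    have "c = 0"
    proof (rule ccontr)
      assume c: "c \<noteq> 0"
      have "P = affine_point (a / c, b / c)"
      proof -
        have "proj_point (a, b, c) = proj_point (a / c, b / c, 1)"
          unfolding proj_point_def
        proof (clarsimp, intro equalityI subsetI)
          fix q assume "q \<in> {(r * a, r * b, r * c) |r. r \<noteq> 0}"
          then obtain r where "q = (r * a, r * b, r * c)" "r \<noteq> 0" by auto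
          then show "q \<in> {(r * a / c, r * b / c, r) |r. r \<noteq> 0}"
            using c by (auto intro!: exI[of _ "r * c"])
        next
          fix q assume "q \<in> {(r * a / c, r * b / c, r) |r. r \<noteq> 0}"
          then obtain r where "q = (r * a / c, r * b / c, r)" "r \<noteq> 0" by auto
          then show "q \<in> {(r * a, r * b, r * c) |r. r \<noteq> 0}"
            using c by (auto intro!: exI[of _ "r / c"])
        qed
        then show ?thesis by (simp add: P affine_point_def)
      qed
      moreover from this have "(b / c) ^ 3 = poly f (a / c)" using on_curve S by metis
      moreover have "a / c \<noteq> ?a"
      proof
        assume ac: "a / c = ?a"
        then have "eval3 (hom_deg 1 (t_minus ?a)) (1 * a, 1 * b, 1 * c) = 0"
          unfolding evalH using c by (simp flip: ac)
        moreover have "eval3 (hom_deg 1 1) (1 * a, 1 * b, 1 * c) \<noteq> 0" unfolding evalG using c by simp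
        ultimately have "\<not> regular_at ?h P" unfolding ratfun_inverse_linear
          by (rule not_regular_at[OF S(1) in_P[of 1, OF one_neq_zero]])
        then show False using S(2) by simp
      qed
      ultimately have "P \<in> affine_point ` T" by (auto simp: T_def)
      then show False using that by simp
    qed
    \<comment> \<open>On the line at infinity the curve is \<open>b\<^sup>3 = a\<^sup>3\<close>, so \<open>a = 0\<close> would force all coordinates to vanish.\<close>
    moreover from this have "a \<noteq> 0"
      using curve nz by (auto simp: eval3_homogenization_cubic)
    ultimately show ?thesis using val[of a b c] S by (auto simp: P)
  qed
  have "curve_integral ?F ?h = (\<Sum>P\<in>affine_point ` T. value_at ?h P)"
    unfolding curve_integral_def
    by (rule sum.mono_neutral_right[OF finite sub]) (intro ballI zero)
  also have "\<dots> = (\<Sum>(t, y)\<in>T. 1 / (t - ?a))"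
    unfolding sum.reindex[OF inj_on_subset[OF inj_affine_point subset_UNIV]]
  proof (rule sum.cong[OF refl])
    fix w assume "w \<in> T"
    then obtain t y where w: "w = (t, y)" "t - ?a * 1 \<noteq> 0" "y ^ 3 = poly f t"
      by (auto simp: T_def)
    from val[of t y 1] w on_curve[of t y]
    have "value_at ?h (affine_point w) = 1 / (t - ?a * 1)" unfolding affine_point_def by simp
    then show "(value_at ?h \<circ> affine_point) w = (case w of (t, y) \<Rightarrow> 1 / (t - ?a))"
      by (simp add: w(1))
  qed
  also have "\<dots> = (\<Sum>t\<in>UNIV - {?a}. of_nat (card {y. y ^ 3 = poly f t}) / (t - ?a))"
    unfolding T_def by (subst sum.Sigma[symmetric]) simp_all
  finally show ?thesis .
qed

section \<open>Specialization of the integral polynomials\<close>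

lemma comm_ring_hom_eval3_of_int:
  "comm_ring_hom (\<lambda>G. eval3 (map_poly (map_poly (map_poly of_int)) G) q :: 'a::comm_ring_1)"
proof -
  interpret A: map_poly_comm_ring_hom "of_int :: int \<Rightarrow> 'a" ..
  interpret B: map_poly_comm_ring_hom "map_poly of_int :: int poly \<Rightarrow> 'a poly" ..
  interpret C: map_poly_comm_ring_hom "map_poly (map_poly of_int) :: int poly2 \<Rightarrow> 'a poly2" ..
  show ?thesis by unfold_locales (simp_all add: hom_distribs)
qed

lemma eval3_of_int_zvar:
  assumes "s \<in> {1, 2, 3}"
  shows "eval3 (map_poly (map_poly (map_poly of_int)) (zvar s)) (x 1, x 2, x 3) = (x s :: 'a::comm_ring_1)"
  using assms by (auto simp: zvar_def eval3_def map_poly_pCons)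

text \<open>
  Polynomial division need not commute with ring homomorphisms, but an exact quotient \<open>Q\<close> is
  determined by \<open>[:- z\<^sub>j, 1:] * Q = P\<close>, and this equation is preserved by reduction modulo \<open>p\<close>
  followed by evaluation. The factor \<open>[:- x j, 1:]\<close> can then be cancelled over the field.
\<close>

lemma eval3_cred:
  fixes x :: "nat \<Rightarrow> 'p::prime_card mod_ring"
  assumes j: "j \<in> {1, 2, 3}" and m: "(p - 1) div 3 = m" "m > 0"
    and f: "(\<Prod>s\<in>{1, 2, 3}. [:- x s, 1:]) = [:- x j, 1:] * g"
  shows "eval3 (cred p i j) (x 1, x 2, x 3) = coeff (g * ([:- x j, 1:] * g) ^ (2 * m - 1)) i"
proof -
  define \<phi> :: "int poly3 \<Rightarrow> 'p mod_ring"
    where "\<phi> = (\<lambda>G. eval3 (map_poly (map_poly (map_poly of_int)) G) (x 1, x 2, x 3))"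
  interpret hom: comm_ring_hom \<phi> unfolding \<phi>_def by (rule comm_ring_hom_eval3_of_int)
  interpret phom: map_poly_comm_ring_hom \<phi> ..
  define N where "N = 2 * m"
  have N: "N = Suc (N - 1)" using m by (simp add: N_def)
  have phi_lin: "map_poly \<phi> [:- zvar s, 1:] = [:- x s, 1:]" if "s \<in> {1, 2, 3}" for s
    using eval3_of_int_zvar[OF that, of x, folded fun_cong[OF \<phi>_def]]
    by (simp add: map_poly_pCons hom.hom_uminus)
  define P :: "int poly3 poly" where "P = (\<Prod>s\<in>{1, 2, 3}. [:- zvar s, 1:] ^ N)"
  have "[:- zvar j, 1:] dvd P"
  proof -
    have "[:- zvar j, 1:] ^ N dvd P" unfolding P_def using j by (intro dvd_prodI) auto
    moreover have "[:- zvar j, 1:] dvd [:- zvar j, 1:] ^ N" by (subst N) (simp only: power_Suc dvd_triv_left)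
    ultimately show ?thesis by (rule dvd_trans[rotated])
  qed
  then obtain Q where Q: "P = [:- zvar j, 1:] * Q" by auto
  have "[:- zvar j, 1:] \<noteq> (0 :: int poly3 poly)" by simp
  then have "P div [:- zvar j, 1:] = Q" unfolding Q by (rule nonzero_mult_div_cancel_left)
  then have cbar: "cbar p i j = coeff Q i" by (simp only: cbar_def m(1) N_def[symmetric] P_def[symmetric])
  have "[:- x j, 1:] * map_poly \<phi> Q = map_poly \<phi> P" by (simp only: Q phom.hom_mult phi_lin[OF j])
  also have "\<dots> = (\<Prod>s\<in>{1, 2, 3}. [:- x s, 1:] ^ N)"
    unfolding P_def phom.hom_prod phom.hom_power by (rule prod.cong) (simp_all only: phi_lin)
  also have "\<dots> = ([:- x j, 1:] * g) ^ N" by (simp only: prod_power_distrib f[symmetric])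
  also have "\<dots> = [:- x j, 1:] * (g * ([:- x j, 1:] * g) ^ (N - 1))"
    by (subst N) (simp only: power_Suc mult.assoc)
  finally have "map_poly \<phi> Q = g * ([:- x j, 1:] * g) ^ (N - 1)"
    by (subst (asm) mult_left_cancel) auto
  moreover have "eval3 (cred p i j) (x 1, x 2, x 3) = coeff (map_poly \<phi> Q) i"
    by (simp only: hom.coeff_map_poly_hom) (simp only: \<phi>_def cred_def cbar)
  ultimately show ?thesis by (simp add: N_def)
qed

theorem theorem1p5:
  fixes p :: nat and x :: "nat \<Rightarrow> 'p::prime_card mod_ring" and j :: nat
  assumes "p = CARD('p)"
    and "prime p"
    and "3 dvd p - 1"
    and "inj_on x {1, 2, 3}"
    and "j \<in> {1, 2, 3}"
  shows "curve_integral (cubic x) (ratfun (cubic x) 1 (t_minus (x j)))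
    = - eval3 (cred p (p - 1) j) (x 1, x 2, x 3)"
proof -
  define m where "m = (p - 1) div 3"
  have p: "p - 1 = 3 * m" using assms(3) by (simp add: m_def)
  have "m \<noteq> 0" using p prime_gt_1_nat[OF assms(2)] by auto
  moreover have "m \<noteq> 1"
  proof
    assume "m = 1"
    with p have "p = 2 * 2" by simp
    with assms(2) show False by (metis prime_product numeral_eq_one_iff semiring_norm(85))
  qed
  ultimately have m: "m \<ge> 2" by simp
  have q: "CARD('p mod_ring) - 1 = 3 * m" using p assms(1) by simp
  define f where "f = (\<Prod>s\<in>{1, 2, 3}. [:- x s, 1:])"
  define g where "g = (\<Prod>s\<in>{1, 2, 3} - {j}. [:- x s, 1:])"
  have fg: "f = [:- x j, 1:] * g"
    unfolding f_def g_def using assms(5) by (intro prod.remove) auto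
  have "degree f = 3" unfolding f_def prod_linear_expand by simp
  then have "(\<Sum>t\<in>UNIV - {x j}. of_nat (card {y. y ^ 3 = poly f t}) / (t - x j))
      = - coeff (g * f ^ (2 * m - 1)) (CARD('p mod_ring) - 1)"
    using sum_card_cube_roots_over_linear[OF q m, of "x j" g] by (simp only: fg)
  moreover have "eval3 (cred p (p - 1) j) (x 1, x 2, x 3) = coeff (g * f ^ (2 * m - 1)) (p - 1)"
    using eval3_cred[OF assms(5) m_def[symmetric], of x g] m fg by (simp add: f_def)
  ultimately show ?thesis
    using curve_integral_affine[OF assms(5), of x] assms(1) by (simp add: f_def)
qed

end
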